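(* Suppose that the solution $x(t,t_0,x_0)$ of (P-ODE) with initial point $x_0$ at time $t_0$ is defined on $[t_0,\infty)$. If $x_0\in\mathcal{M}(t_0)$, then $x(t,t_0,x_0)\in\mathcal{M}(t)$ for all $t\ge t_0$.
   Context: Let $f:\mathbb{R}^n\times[0,\infty)\to\mathbb{R}$ and $g=(g_1,\dots,g_m)$ with $g_k:\mathbb{R}^n\times[0,\infty)\to\mathbb{R}$. Write $\mathcal{J}_g(x,t)=\partial g(x,t)/\partial x\in\mathbb{R}^{m\times n}$, $g'(x,t)=\partial g(x,t)/\partial t$, and $\mathcal{M}(t)=\{x\in\mathbb{R}^n: g(x,t)=0\}$. Define $\mathcal{P}(x,t)=I_n-\mathcal{J}_g^\top(\mathcal{J}_g\mathcal{J}_g^\top)^{-1}\mathcal{J}_g$ and $\mathcal{Q}(x,t)=\mathcal{J}_g^\top(\mathcal{J}_g\mathcal{J}_g^\top)^{-1}$ (with $\mathcal{J}_g=\mathcal{J}_g(x,t)$), wherever $\mathcal{J}_g\mathcal{J}_g^\top$ is invertible. (P-ODE), with a constant $\alpha>0$: $\dot x(t)=-\frac1\alpha\mathcal{P}(x(t),t)\nabla_x f(x(t),t)-\mathcal{Q}(x(t),t)g'(x(t),t)$; a solution is understood to be one along which the right-hand side is defined. Standing assumptions: $f$ is twice continuously differentiable in $x$ and continuously differentiable in $t\ge0$; each $g_k$ is twice continuously differentiable in $x$ and twice continuously differentiable in $t\ge0$; there is a constant $M$ with $f(x,t)\ge M$ for all $t\ge0$, $x\in\mathcal{M}(t)$;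 $\mathcal{M}(t)\ne\emptyset$ for all $t\ge0$; $\mathcal{J}_g(x,t)$ has full row rank for all $t\ge0$ and $x\in\mathcal{M}(t)$. *)

theory Defs
  imports "HOL-Analysis.Analysis"
begin

definition gradient :: "('a::real_inner \<Rightarrow> real) \<Rightarrow> 'a \<Rightarrow> 'a" where
  "gradient h x = (THE D. GDERIV h x :> D)"

lemma gradient_eq:
  assumes "GDERIV h x :> D"
  shows "gradient h x = D"
  unfolding gradient_def
proof (rule the_equality)
  show "GDERIV h x :> D" by (fact assms)
next
  fix E assume "GDERIV h x :> E"
  with assms have "(\<lambda>v. inner v E) = (\<lambda>v. inner v D)"
    unfolding gderiv_def by (blast intro: has_derivative_unique)
  then have "\<forall>v. inner v E = inner v D" by (simp add: fun_eq_iff)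
  then show "E = D" by (simp only: vector_eq_ldot)
qed

text \<open>Functions of space and time are curried and only their values at times \<open>t \<ge> 0\<close>
  matter. Accordingly, time derivatives are taken within \<open>[0,\<infinity>)\<close>, so they are
  one-sided at \<open>t = 0\<close>.\<close>

definition time_deriv ::
    "('a \<Rightarrow> real \<Rightarrow> 'b::real_normed_vector) \<Rightarrow> 'a \<Rightarrow> real \<Rightarrow> 'b" where
  "time_deriv h x t = vector_derivative (\<lambda>s. h x s) (at t within {0..})"

text \<open>In the following definitions, continuity of partial derivatives means joint continuity
  in \<open>(x,t)\<close>. Continuity in each variable separately would not give the chain rule
  along curves \<open>t \<mapsto> (x(t), t)\<close>.\<close>

definition C2_in_space :: "(real^'n \<Rightarrow> real \<Rightarrow> real) \<Rightarrow> bool" where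
  "C2_in_space h \<longleftrightarrow>
     (\<forall>x. \<forall>t\<ge>0. (\<lambda>y. h y t) differentiable (at x)) \<and>
     continuous_on (UNIV \<times> {0..}) (\<lambda>(x, t). gradient (\<lambda>y. h y t) x) \<and>
     (\<forall>x. \<forall>t\<ge>0. gradient (\<lambda>y. h y t) differentiable (at x)) \<and>
     continuous_on (UNIV \<times> {0..}) (\<lambda>(x, t). jacobian (gradient (\<lambda>y. h y t)) (at x))"

definition C1_in_time :: "(real^'n \<Rightarrow> real \<Rightarrow> real) \<Rightarrow> bool" where
  "C1_in_time h \<longleftrightarrow>
     (\<forall>x. \<forall>t\<ge>0. (\<lambda>s. h x s) differentiable (at t within {0..})) \<and>
     continuous_on (UNIV \<times> {0..}) (\<lambda>(x, t). time_deriv h x t)"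

definition C2_in_time :: "(real^'n \<Rightarrow> real \<Rightarrow> real) \<Rightarrow> bool" where
  "C2_in_time h \<longleftrightarrow> C1_in_time h \<and> C1_in_time (time_deriv h)"

definition feasible_set :: "(real^'n \<Rightarrow> real \<Rightarrow> real^'m) \<Rightarrow> real \<Rightarrow> (real^'n) set" where
  "feasible_set g t = {x. g x t = 0}"

definition Jac :: "(real^'n \<Rightarrow> real \<Rightarrow> real^'m) \<Rightarrow> real^'n \<Rightarrow> real \<Rightarrow> real^'n^'m" where
  "Jac g x t = jacobian (\<lambda>y. g y t) (at x)"

text \<open>The following two matrices are meaningful only where the Gram matrix
  \<open>Jac g x t ** transpose (Jac g x t)\<close> is invertible.\<close>

definition Pmat :: "(real^'n \<Rightarrow> real \<Rightarrow> real^'m) \<Rightarrow> real^'n \<Rightarrow> real \<Rightarrow> real^'n^'n" where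
  "Pmat g x t =
     mat 1 - transpose (Jac g x t) ** matrix_inv (Jac g x t ** transpose (Jac g x t)) ** Jac g x t"

definition Qmat :: "(real^'n \<Rightarrow> real \<Rightarrow> real^'m) \<Rightarrow> real^'n \<Rightarrow> real \<Rightarrow> real^'m^'n" where
  "Qmat g x t = transpose (Jac g x t) ** matrix_inv (Jac g x t ** transpose (Jac g x t))"

definition P_ODE_rhs ::
    "real \<Rightarrow> (real^'n \<Rightarrow> real \<Rightarrow> real) \<Rightarrow> (real^'n \<Rightarrow> real \<Rightarrow> real^'m) \<Rightarrow> real^'n \<Rightarrow> real \<Rightarrow> real^'n" where
  "P_ODE_rhs \<alpha> f g x t =
     - ((1 / \<alpha>) *\<^sub>R (Pmat g x t *v gradient (\<lambda>y. f y t) x)) - Qmat g x t *v time_deriv g x t"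

text \<open>Solutions on \<open>[t0,\<infinity>)\<close>. Invertibility of the Gram matrix along the curve
  expresses that the right-hand side is defined there.\<close>

definition P_ODE_solution ::
    "real \<Rightarrow> (real^'n \<Rightarrow> real \<Rightarrow> real) \<Rightarrow> (real^'n \<Rightarrow> real \<Rightarrow> real^'m) \<Rightarrow>
     real \<Rightarrow> real^'n \<Rightarrow> (real \<Rightarrow> real^'n) \<Rightarrow> bool" where
  "P_ODE_solution \<alpha> f g t0 x0 x \<longleftrightarrow>
     x t0 = x0 \<and>
     (\<forall>t\<ge>t0. invertible (Jac g (x t) t ** transpose (Jac g (x t) t)) \<and>
        (x has_vector_derivative P_ODE_rhs \<alpha> f g (x t) t) (at t within {t0..}))"

end

theory Submission
  imports Defs
begin

text \<open>
  Along a solution, the chain rule gives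
  \<open>d/dt g(x(t),t) = J x'(t) + g'\<close>. Multiplying the right-hand side of the ODE by \<open>J\<close>
  and using \<open>J P = 0\<close> and \<open>J Q = I\<close> turns this into \<open>- g' + g' = 0\<close>, so \<open>g(x(t),t)\<close> is
  constant.
\<close>

lemma matrix_inv_right:
  fixes A :: "'a::semiring_1^'n^'m"
  assumes "invertible A"
  shows "A ** matrix_inv A = mat 1"
  using someI_ex[OF assms[unfolded invertible_def]] unfolding matrix_inv_def by blast

lemma Jac_mult_Qmat:
  assumes "invertible (Jac g x t ** transpose (Jac g x t))"
  shows "Jac g x t ** Qmat g x t = mat 1"
  using matrix_inv_right[OF assms] by (simp add: Qmat_def matrix_mul_assoc)

text \<open>Since P = I - Q J, the product J P v equals J v - (J Q) J v, which vanishes because J Q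
  = I.\<close>

lemma Jac_mult_Pmat_vector:
  assumes "invertible (Jac g x t ** transpose (Jac g x t))"
  shows "Jac g x t *v (Pmat g x t *v v) = 0"
proof -
  have "Pmat g x t *v v = v - Qmat g x t *v (Jac g x t *v v)"
    by (simp add: Pmat_def Qmat_def matrix_vector_mult_diff_rdistrib matrix_vector_mul_assoc)
  then show ?thesis
    by (simp add: matrix_vector_mult_diff_distrib matrix_vector_mul_assoc matrix_mul_assoc
        Jac_mult_Qmat[OF assms])
qed

lemma Jac_mult_P_ODE_rhs:
  assumes "invertible (Jac g x t ** transpose (Jac g x t))"
  shows "Jac g x t *v P_ODE_rhs \<alpha> f g x t = - time_deriv g x t"
  using Jac_mult_Pmat_vector[OF assms]
  by (simp add: P_ODE_rhs_def matrix_vector_mult_diff_distrib matrix_vector_mul_assoc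
      Jac_mult_Qmat[OF assms] vec.neg matrix_vector_mult_scaleR)

text \<open>The basis vectors of \<open>real^'m\<close> are the \<open>axis k 1\<close>, so inner
  products with them are coordinates. This links the smoothness assumptions, made for each g_k, to
  \<open>Jac\<close> and \<open>time_deriv\<close> of the vector-valued g.\<close>

lemma has_derivative_componentwise_vec:
  fixes f :: "'a::real_normed_vector \<Rightarrow> real^'m"
  shows "(f has_derivative f') (at a within S) \<longleftrightarrow>
    (\<forall>k. ((\<lambda>x. f x $ k) has_derivative (\<lambda>x. f' x $ k)) (at a within S))"
  by (subst has_derivative_componentwise_within) (auto simp: Basis_vec_def inner_axis)

text \<open>Existence behind the definite description \<open>gradient\<close>: by Riesz
  representation a linear functional D on a Euclidean space is the inner product with the sum of
  \<open>D b *\<^sub>R b\<close> over the basis.\<close>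

lemma gderiv_gradient:
  fixes h :: "'a::euclidean_space \<Rightarrow> real"
  assumes "h differentiable (at x)"
  shows "GDERIV h x :> gradient h x"
proof -
  obtain D where D: "(h has_derivative D) (at x)"
    using assms unfolding differentiable_def by blast
  have "D v = v \<bullet> (\<Sum>b\<in>Basis. D b *\<^sub>R b)" for v
  proof -
    have "D (\<Sum>b\<in>Basis. (v \<bullet> b) *\<^sub>R b) = v \<bullet> (\<Sum>b\<in>Basis. D b *\<^sub>R b)"
      by (simp add: linear_sum[OF has_derivative_linear[OF D]]
          linear_scale[OF has_derivative_linear[OF D]] inner_sum_right mult.commute)
    then show ?thesis by (simp add: euclidean_representation)
  qed
  then have "D = (\<lambda>v. v \<bullet> (\<Sum>b\<in>Basis. D b *\<^sub>R b))"
    by (rule ext)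
  with D have "GDERIV h x :> (\<Sum>b\<in>Basis. D b *\<^sub>R b)"
    unfolding gderiv_def by (rule back_subst)
  then show ?thesis
    by (simp add: gradient_eq)
qed

lemma has_vector_derivative_time_deriv:
  assumes "C1_in_time h" "t \<ge> 0"
  shows "((\<lambda>s. h x s) has_vector_derivative time_deriv h x t) (at t within {0..})"
  using assms unfolding C1_in_time_def time_deriv_def
  by (auto simp: vector_derivative_works)

text \<open>The chain rule needs h to be differentiable jointly in time and space. This follows from
  a time derivative at the given point together with a space gradient that is jointly
  continuous.\<close>

lemma has_vector_derivative_along_curve:
  fixes h :: "real^'n \<Rightarrow> real \<Rightarrow> real"
  assumes space: "C2_in_space h" and time: "C1_in_time h"
    and t0: "t0 \<ge> 0" and t: "t \<ge> t0"
    and x: "(x has_vector_derivative v) (at t within {t0..})"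
  shows "((\<lambda>s. h (x s) s) has_vector_derivative
           time_deriv h (x t) t + v \<bullet> gradient (\<lambda>y. h y t) (x t)) (at t within {t0..})"
proof -
  \<comment> \<open>The gradient is read as a bounded linear map and time is put first:
    \<open>has_derivative_partialsI\<close> asks for a continuous \<open>blinfun\<close>-valued
    partial derivative in the second variable, but for a derivative at one point only in the
    first.\<close>
  let ?G = "\<lambda>s y. blinfun_inner_left (gradient (\<lambda>y. h y s) y)"
  have "((\<lambda>(s, y). h y s) has_derivative
          (\<lambda>(ds, dy). ds *\<^sub>R time_deriv h (x t) t + ?G t (x t) dy))
        (at (t, x t) within {0..} \<times> UNIV)"
  proof (rule has_derivative_partialsI)
    show "((\<lambda>s. h (x t) s) has_derivative (\<lambda>ds. ds *\<^sub>R time_deriv h (x t) t)) (at t within {0..})"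
      using has_vector_derivative_time_deriv[OF time] t0 t
      by (simp add: has_vector_derivative_def)
  next
    fix s :: real and y :: "real^'n" assume "s \<in> {0..}"
    then show "((\<lambda>y. h y s) has_derivative blinfun_apply (?G s y)) (at y within UNIV)"
      using space gderiv_gradient[of "\<lambda>y. h y s" y]
      by (simp add: C2_in_space_def gderiv_def)
  next
    have "continuous_on (UNIV \<times> {0..}) (\<lambda>(y, s). gradient (\<lambda>y. h y s) y)"
      using space unfolding C2_in_space_def by blast
    then have "continuous_on ({0..} \<times> UNIV)
        (\<lambda>p. (\<lambda>(y, s). gradient (\<lambda>y. h y s) y) (snd p, fst p))"
      by (rule continuous_on_compose2) (auto intro!: continuous_intros)
    from bounded_linear.continuous_on[OF bounded_linear_blinfun_inner_left this]
    have "continuous_on ({0..} \<times> UNIV) (\<lambda>(s, y). ?G s y)"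
      by (simp add: case_prod_unfold)
    then show "continuous (at (t, x t) within {0..} \<times> UNIV) (\<lambda>(s, y). ?G s y)"
      using t0 t by (simp add: continuous_on_eq_continuous_within)
  qed auto
  \<comment> \<open>\<open>diff_chain_within\<close> differentiates the outer function within the
    image of the inner one. The graph of the curve stays in \<open>{0..} \<times> UNIV\<close>
    because t0 \<ge> 0.\<close>
  then have "((\<lambda>(s, y). h y s) has_derivative
          (\<lambda>(ds, dy). ds *\<^sub>R time_deriv h (x t) t + ?G t (x t) dy))
        (at (t, x t) within (\<lambda>s. (s, x s)) ` {t0..})"
    by (rule has_derivative_subset) (use t0 in auto)
  moreover have "((\<lambda>s. (s, x s)) has_derivative (\<lambda>ds. (ds, ds *\<^sub>R v))) (at t within {t0..})"
    using x unfolding has_vector_derivative_def by (intro has_derivative_Pair has_derivative_ident)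
  ultimately have "((\<lambda>(s, y). h y s) \<circ> (\<lambda>s. (s, x s)) has_derivative
      (\<lambda>(ds, dy). ds *\<^sub>R time_deriv h (x t) t + ?G t (x t) dy) \<circ> (\<lambda>ds. (ds, ds *\<^sub>R v)))
      (at t within {t0..})"
    by (rule diff_chain_within[rotated])
  then show ?thesis
    by (simp add: has_vector_derivative_def o_def distrib_left)
qed

text \<open>Both sides are the derivative of g_k in direction v, so uniqueness of derivatives
  identifies them. Differentiability of the whole map, which \<open>jacobian_works\<close> requires,
  is first assembled from the components.\<close>

lemma Jac_mult_vector_nth:
  fixes g :: "real^'n \<Rightarrow> real \<Rightarrow> real^'m"
  assumes "\<And>k. (\<lambda>y. g y t $ k) differentiable (at x)"
  shows "(Jac g x t *v v) $ k = v \<bullet> gradient (\<lambda>y. g y t $ k) x"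
proof -
  have "((\<lambda>y. g y t) has_derivative (\<lambda>v. \<chi> j. v \<bullet> gradient (\<lambda>y. g y t $ j) x)) (at x)"
    using gderiv_gradient[OF assms] by (simp add: has_derivative_componentwise_vec gderiv_def)
  then have "(\<lambda>y. g y t) differentiable (at x)"
    by (rule differentiableI)
  then have "((\<lambda>y. g y t) has_derivative (\<lambda>v. Jac g x t *v v)) (at x)"
    by (simp add: Jac_def jacobian_works)
  then have "((\<lambda>y. g y t $ k) has_derivative (\<lambda>v. (Jac g x t *v v) $ k)) (at x)"
    by (rule bounded_linear.has_derivative[OF bounded_linear_vec_nth])
  moreover have "((\<lambda>y. g y t $ k) has_derivative (\<lambda>v. v \<bullet> gradient (\<lambda>y. g y t $ k) x)) (at x)"
    using gderiv_gradient[OF assms] by (simp add: gderiv_def)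
  ultimately show ?thesis
    by (rule has_derivative_unique[THEN fun_cong])
qed

lemma time_deriv_component:
  fixes g :: "real^'n \<Rightarrow> real \<Rightarrow> real^'m"
  assumes "\<And>k. C1_in_time (\<lambda>y s. g y s $ k)" "t \<ge> 0"
  shows "time_deriv g x t $ k = time_deriv (\<lambda>y s. g y s $ k) x t"
proof -
  have "((\<lambda>s. g x s) has_vector_derivative (\<chi> k. time_deriv (\<lambda>y s. g y s $ k) x t))
      (at t within {0..})"
    using has_vector_derivative_time_deriv[OF assms]
    by (simp add: has_vector_derivative_def has_derivative_componentwise_vec)
  \<comment> \<open>A derivative within \<open>{0..}\<close> is unique only if t is a limit point of
    that set; the interval to the right of t shows this also at t = 0.\<close>
  moreover have "at t within {0..} \<noteq> bot"
    using islimpt_Icc[of t "t + 1" t] islimpt_subset[of t "{t..t + 1}" "{0..}"] \<open>t \<ge> 0\<close>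
    by (simp add: trivial_limit_within)
  ultimately show ?thesis
    by (simp add: time_deriv_def[of g] vector_derivative_within)
qed

theorem lemma3:
  fixes f :: "real^'n \<Rightarrow> real \<Rightarrow> real"
    and g :: "real^'n \<Rightarrow> real \<Rightarrow> real^'m"
    and \<alpha> t0 :: real
    and x0 :: "real^'n"
    and x :: "real \<Rightarrow> real^'n"
  assumes "\<alpha> > 0"
    and "C2_in_space f" and "C1_in_time f"
    and "\<And>k. C2_in_space (\<lambda>y t. g y t $ k)"
    and "\<And>k. C2_in_time (\<lambda>y t. g y t $ k)"
    and "\<exists>M. \<forall>t\<ge>0. \<forall>y\<in>feasible_set g t. f y t \<ge> M"
    and "\<And>t. t \<ge> 0 \<Longrightarrow> feasible_set g t \<noteq> {}"
    and "\<And>t y. t \<ge> 0 \<Longrightarrow> y \<in> feasible_set g t \<Longrightarrow> rank (Jac g y t) = CARD('m)"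
    and "t0 \<ge> 0"
    and "P_ODE_solution \<alpha> f g t0 x0 x"
    and "x0 \<in> feasible_set g t0"
  shows "\<forall>t\<ge>t0. x t \<in> feasible_set g t"
proof -
  have C1: "C1_in_time (\<lambda>y t. g y t $ k)" for k
    using assms(5) by (simp add: C2_in_time_def)
  have const: "((\<lambda>s. g (x s) s $ k) has_vector_derivative 0) (at t within {t0..})"
    if t: "t \<in> {t0..}" for t k
  proof -
    let ?v = "P_ODE_rhs \<alpha> f g (x t) t"
    have t_nonneg: "t \<ge> 0" using t \<open>t0 \<ge> 0\<close> by simp
    \<comment> \<open>Invertibility is taken from the notion of solution, so the argument does not
      presuppose that \<open>x t\<close> lies in \<open>feasible_set g t\<close>.\<close>
    have sol: "invertible (Jac g (x t) t ** transpose (Jac g (x t) t))"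
      "(x has_vector_derivative ?v) (at t within {t0..})"
      using assms(10) t by (auto simp: P_ODE_solution_def)
    have "(\<lambda>y. g y t $ j) differentiable (at (x t))" for j
      using assms(4) t_nonneg by (simp add: C2_in_space_def)
    \<comment> \<open>This is the k-th row of J x' = - g', in the form that cancels against the time
      derivative in the chain rule.\<close>
    then have "?v \<bullet> gradient (\<lambda>y. g y t $ k) (x t) = - time_deriv (\<lambda>y s. g y s $ k) (x t) t"
      using Jac_mult_P_ODE_rhs[OF sol(1), of \<alpha> f]
      by (simp add: Jac_mult_vector_nth[symmetric] time_deriv_component[OF C1 t_nonneg, symmetric])
    then show ?thesis
      using has_vector_derivative_along_curve[OF assms(4) C1 \<open>t0 \<ge> 0\<close> _ sol(2), of k] t by simp
  qed
  have "g (x t) t $ k = 0" if "t \<ge> t0" for t k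
  proof -
    \<comment> \<open>A vanishing derivative on the convex set \<open>{t0..}\<close> gives a
      constant, whose value is read off at t0, where \<open>x0\<close> is feasible.\<close>
    obtain c where "\<And>s. s \<in> {t0..} \<Longrightarrow> g (x s) s $ k = c"
      using has_vector_derivative_zero_constant[OF convex_real_interval(1) const] by blast
    moreover have "g (x t0) t0 $ k = 0"
      using assms(10,11) by (simp add: P_ODE_solution_def feasible_set_def)
    ultimately show ?thesis using that by simp
  qed
  then show ?thesis by (simp add: feasible_set_def vec_eq_iff)
qed

end
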